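(* Let $A\subset\mathbb{R}^d$ be a nonempty roughly shift-invariant set. Then there exists a number $D>0$ (the density of $A$) such that, uniformly with respect to $x\in\mathbb{R}^d$, $$\lim_{T\to\infty}\frac{\#(A\cap B(x,T))}{m_d(B(x,T))}=D.$$
   Context: A set $A\subset\mathbb{R}^d$ is called discrete if its intersection with any ball is finite. A discrete set $A\subset\mathbb{R}^d$ is called roughly shift-invariant if there exists $L<\infty$ such that for every $x\in\mathbb{R}^d$ there is a bijection $\sigma_x:A\to A$ with $\sup_{a\in A}|a+x-\sigma_x(a)|<L$ (the constant $L$ does not depend on $x$; the notion does not depend on the choice of norm on $\mathbb{R}^d$). Here $\#E$ is the number of points of a finite set $E$, $m_d$ is $d$-dimensional Lebesgue measure, and $B(x,T)$ is the open ball of radius $T$ centered at $x$. *)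

theory Defs
  imports "HOL-Analysis.Analysis"
begin

(* Every ball meets A in a finite set. This is stronger than the topological notion of a set all
   of whose points are isolated, since it also excludes accumulation points outside A. *)
definition discrete_set :: "(real ^ 'n) set \<Rightarrow> bool" where
  "discrete_set A \<longleftrightarrow> (\<forall>x r. finite (A \<inter> ball x r))"

(* The supremum is taken in the extended reals, because a supremum of an unbounded set of reals
   is unspecified and would not express boundedness. *)
definition roughly_shift_invariant :: "(real ^ 'n) set \<Rightarrow> bool" where
  "roughly_shift_invariant A \<longleftrightarrow>
     discrete_set A \<and>
     (\<exists>L::real. \<forall>x. \<exists>\<sigma>. bij_betw \<sigma> A A \<and>
        (SUP a\<in>A. ereal (norm (a + x - \<sigma> a))) < ereal L)"

end

theory Submission
  imports Defs
begin

text \<open>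
  Write \<open>N x T\<close> for the number of points of \<open>A\<close> in the ball of radius \<open>T\<close> about \<open>x\<close>, and \<open>v T\<close> for
  the volume of that ball. The bijection belonging to the shift \<open>y - x\<close> moves the points of the
  first of two balls into a slight enlargement of the second, so \<open>N x T \<le> N y (T + L)\<close> for all \<open>x\<close>
  and \<open>y\<close> (\<open>card_ball_shift_le\<close>): up to a change \<open>L\<close> of the radius, counts do not depend on the
  centre.

  The other ingredient holds for every locally finite set. Averaging \<open>N x T\<close> over the centres \<open>x\<close> in
  a huge ball gives, up to boundary effects, \<open>v T\<close> times the number of points per unit volume in
  the huge ball. Comparing the averages for two radii \<open>S\<close> and \<open>T\<close>, a uniform lower bound \<open>m\<close> of
  \<open>N x S\<close> and a uniform upper bound \<open>M\<close> of \<open>N x T\<close> satisfy \<open>m / v S \<le> M / v T\<close>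
  (\<open>uniform_counts_compare\<close>).

  Together these yield \<open>N 0 (S - L) / v S \<le> N 0 (T + L) / v T\<close> for all positive \<open>S\<close> and \<open>T\<close>. The
  supremum \<open>D\<close> of the left-hand sides therefore lies between the two sides, and another change of
  centre gives \<open>D * v (T - 2 * L) \<le> N x T \<le> D * v (T + 2 * L)\<close> for \<open>T > 2 * L\<close>
  (\<open>density_sandwich\<close>, with \<open>T ^ d\<close> in place of \<open>v T\<close>). As the ratios of these
  volumes to \<open>v T\<close> tend to 1, this is the claim, uniformly in \<open>x\<close> because the bounds do not
  involve \<open>x\<close>.
\<close>

lemma roughly_shift_invariantE:
  fixes A :: "(real ^ 'n) set"
  assumes "A \<noteq> {}" and "roughly_shift_invariant A"
  obtains L :: real where "L > 0"
    and "\<And>x. \<exists>\<sigma>. bij_betw \<sigma> A A \<and> (\<forall>a\<in>A. norm (a + x - \<sigma> a) < L)"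
proof -
  from assms(2) obtain L :: real where L: "\<And>x. \<exists>\<sigma>. bij_betw \<sigma> A A \<and>
        (SUP a\<in>A. ereal (norm (a + x - \<sigma> a))) < ereal L"
    unfolding roughly_shift_invariant_def by blast
  have close: "\<exists>\<sigma>. bij_betw \<sigma> A A \<and> (\<forall>a\<in>A. norm (a + x - \<sigma> a) < L)" for x
  proof -
    obtain \<sigma> where \<sigma>: "bij_betw \<sigma> A A" "(SUP a\<in>A. ereal (norm (a + x - \<sigma> a))) < ereal L"
      using L by blast
    have "norm (a + x - \<sigma> a) < L" if "a \<in> A" for a
      using le_less_trans[OF SUP_upper[OF that] \<sigma>(2)] by simp
    with \<sigma>(1) show ?thesis by blast
  qed
  from close[of 0] assms(1) have "L > 0"
    by (metis ex_in_conv norm_ge_zero le_less_trans)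
  with close show thesis by (rule that[rotated])
qed

lemma card_ball_shift_le:
  fixes A :: "'a::real_normed_vector set"
  assumes fin: "\<And>x r. finite (A \<inter> ball x r)"
    and shift: "\<And>x. \<exists>\<sigma>. bij_betw \<sigma> A A \<and> (\<forall>a\<in>A. norm (a + x - \<sigma> a) < L)"
  shows "card (A \<inter> ball x T) \<le> card (A \<inter> ball y (T + L))"
proof -
  obtain \<sigma> where \<sigma>: "bij_betw \<sigma> A A" "\<And>a. a \<in> A \<Longrightarrow> norm (a + (y - x) - \<sigma> a) < L"
    using shift by blast
  have "\<sigma> a \<in> A \<inter> ball y (T + L)" if "a \<in> A \<inter> ball x T" for a
  proof -
    have "y - \<sigma> a = (x - a) + (a + (y - x) - \<sigma> a)" by simp
    then have "norm (y - \<sigma> a) \<le> norm (x - a) + norm (a + (y - x) - \<sigma> a)"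
      by (metis norm_triangle_ineq)
    with that \<sigma>(2)[of a] have "norm (y - \<sigma> a) < T + L" by (simp add: dist_norm)
    with that \<sigma>(1) show ?thesis by (auto simp: dist_norm bij_betw_apply)
  qed
  then have "\<sigma> ` (A \<inter> ball x T) \<subseteq> A \<inter> ball y (T + L)" by blast
  moreover have "inj_on \<sigma> (A \<inter> ball x T)"
    using \<sigma>(1) by (auto simp: bij_betw_def intro: inj_on_subset)
  ultimately show ?thesis using fin by (rule_tac card_inj_on_le)
qed

text \<open>
  Counting the pairs of a point \<open>a \<in> F\<close> and a centre \<open>x\<close> at distance less than \<open>T\<close> in two ways:
  every \<open>a\<close> contributes the volume of the ball of centres that see it.
\<close>

lemma has_bochner_integral_card_ball:
  fixes F :: "'a::euclidean_space set"
  assumes "finite F" and "T \<ge> 0"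
  shows "has_bochner_integral lborel (\<lambda>x. real (card (F \<inter> ball x T)))
           (real (card F) * (unit_ball_vol (real DIM('a)) * T ^ DIM('a)))"
proof -
  have "has_bochner_integral lborel (\<lambda>x. \<Sum>a\<in>F. indicator (ball a T) x :: real)
          (\<Sum>a\<in>F. measure lborel (ball a T))"
    by (intro has_bochner_integral_sum has_bochner_integral_real_indicator)
       (use emeasure_bounded_finite[OF bounded_ball] in auto)
  also have "(\<lambda>x. \<Sum>a\<in>F. indicator (ball a T) x :: real) = (\<lambda>x. real (card (F \<inter> ball x T)))"
  proof
    fix x
    have "(\<Sum>a\<in>F. indicator (ball a T) x :: real) = (\<Sum>a\<in>F. indicator (ball x T) a)"
      by (intro sum.cong) (auto simp: indicator_def dist_commute)
    then show "(\<Sum>a\<in>F. indicator (ball a T) x :: real) = real (card (F \<inter> ball x T))"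
      using assms(1) by (simp add: indicator_def sum.If_cases del: mem_ball)
  qed
  finally show ?thesis using assms(2) by (simp add: content_ball)
qed

lemma has_bochner_integral_mono:
  fixes f g :: "'a \<Rightarrow> real"
  assumes "has_bochner_integral M f a" "has_bochner_integral M g b" "\<And>x. f x \<le> g x"
  shows "a \<le> b"
  using assms integral_mono[of M f g] by (simp add: has_bochner_integral_iff)

lemma has_bochner_integral_indicator_ball:
  fixes c :: "'a::euclidean_space"
  assumes "r \<ge> 0"
  shows "has_bochner_integral lborel (\<lambda>x. m * indicator (ball c r) x :: real)
           (m * (unit_ball_vol (real DIM('a)) * r ^ DIM('a)))"
  using has_bochner_integral_mult_right[OF has_bochner_integral_real_indicator
      [of "ball c r" lborel], of m] assms emeasure_bounded_finite[OF bounded_ball, of c r]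
  by (simp add: content_ball)

text \<open>
  The next two lemmas compare the number of points in a large ball with the average count. The
  enlargement of the large ball absorbs the boundary effect: in the first, points outside the
  ball of centres are counted, in the second, centres outside the ball of points.
\<close>

lemma lower_count_le_card_large_ball:
  fixes A :: "'a::euclidean_space set"
  assumes fin: "\<And>x r. finite (A \<inter> ball x r)"
    and lower: "\<And>x. m \<le> real (card (A \<inter> ball x S))" and "S \<ge> 0" "R \<ge> 0"
  shows "m * R ^ DIM('a) \<le> real (card (A \<inter> ball 0 (R + S))) * S ^ DIM('a)"
proof -
  let ?F = "A \<inter> ball 0 (R + S)" and ?c = "unit_ball_vol (real DIM('a))"
  have "m * indicator (ball 0 R) x \<le> real (card (?F \<inter> ball x S))" for x
  proof (cases "x \<in> ball 0 R")
    case True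
    then have "ball x S \<subseteq> ball 0 (R + S)"
      by (simp add: ball_subset_ball_iff dist_commute)
    then have "?F \<inter> ball x S = A \<inter> ball x S" by blast
    with True lower[of x] show ?thesis by simp
  qed simp
  then have "m * (?c * R ^ DIM('a)) \<le> real (card ?F) * (?c * S ^ DIM('a))"
    using has_bochner_integral_mono[OF has_bochner_integral_indicator_ball[of R m 0]
        has_bochner_integral_card_ball[of ?F S]] assms by blast
  moreover have "?c > 0" by (rule unit_ball_vol_pos) simp
  ultimately show ?thesis by (simp add: mult.left_commute)
qed

lemma card_large_ball_le_upper_count:
  fixes A :: "'a::euclidean_space set"
  assumes fin: "\<And>x r. finite (A \<inter> ball x r)"
    and upper: "\<And>x. real (card (A \<inter> ball x T)) \<le> M" and "T \<ge> 0" "Q \<ge> 0"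
  shows "real (card (A \<inter> ball 0 Q)) * T ^ DIM('a) \<le> M * (Q + T) ^ DIM('a)"
proof -
  let ?F = "A \<inter> ball 0 Q" and ?c = "unit_ball_vol (real DIM('a))"
  have "real (card (?F \<inter> ball x T)) \<le> M * indicator (ball 0 (Q + T)) x" for x
  proof (cases "x \<in> ball 0 (Q + T)")
    case True
    have "card (?F \<inter> ball x T) \<le> card (A \<inter> ball x T)"
      by (intro card_mono fin) auto
    with True upper[of x] show ?thesis by simp
  next
    case False
    have "ball 0 Q \<inter> ball x T = {}"
      using False by (intro disjoint_ballI) (simp add: dist_commute)
    then have "?F \<inter> ball x T = {}" by blast
    with False show ?thesis by simp
  qed
  then have "real (card ?F) * (?c * T ^ DIM('a)) \<le> M * (?c * (Q + T) ^ DIM('a))"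
    using has_bochner_integral_mono[OF has_bochner_integral_card_ball[of ?F T]
        has_bochner_integral_indicator_ball[of "Q + T" M 0]] assms by force
  moreover have "?c > 0" by (rule unit_ball_vol_pos) simp
  ultimately show ?thesis by (simp add: mult.left_commute)
qed

text \<open>
  Both averages are taken over balls of radius about \<open>R\<close>; the relative boundary error disappears
  as \<open>R\<close> grows. The common constant in the volumes of the balls is cancelled.
\<close>

lemma uniform_counts_compare:
  fixes A :: "'a::euclidean_space set"
  assumes fin: "\<And>x r. finite (A \<inter> ball x r)"
    and lower: "\<And>x. m \<le> real (card (A \<inter> ball x S))" and "S > 0"
    and upper: "\<And>x. real (card (A \<inter> ball x T)) \<le> M" and "T > 0"
  shows "m / S ^ DIM('a) \<le> M / T ^ DIM('a)"
proof -
  let ?d = "DIM('a)"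
  have bound: "m * T ^ ?d \<le> M * S ^ ?d * ((R + (S + T)) / R) ^ ?d" if "R > 0" for R
  proof -
    have "m * R ^ ?d * T ^ ?d \<le> real (card (A \<inter> ball 0 (R + S))) * T ^ ?d * S ^ ?d"
      using lower_count_le_card_large_ball[OF fin lower, of R] assms(3,5) that
      by (simp add: mult.commute mult.left_commute)
    also have "\<dots> \<le> M * (R + S + T) ^ ?d * S ^ ?d"
      using card_large_ball_le_upper_count[OF fin upper, of "R + S"] assms(3,5) that
      by (intro mult_right_mono) simp_all
    finally show ?thesis
      using that by (simp add: power_divide field_simps)
  qed
  have "((\<lambda>R::real. (R + (S + T)) / R) \<longlongrightarrow> 1) at_top"
  proof (rule Lim_transform_eventually)
    show "((\<lambda>R::real. 1 + (S + T) / R) \<longlongrightarrow> 1) at_top"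
      using tendsto_add[OF tendsto_const
          tendsto_divide_0[OF tendsto_const filterlim_ident[THEN filterlim_at_top_imp_at_infinity]]]
      by fastforce
    show "\<forall>\<^sub>F R in at_top. 1 + (S + T) / R = (R + (S + T)) / R"
      using eventually_gt_at_top[of "0::real"] by eventually_elim (simp add: field_simps)
  qed
  from tendsto_mult[OF tendsto_const tendsto_power[OF this]]
  have "((\<lambda>R. M * S ^ ?d * ((R + (S + T)) / R) ^ ?d) \<longlongrightarrow> M * S ^ ?d * 1 ^ ?d) at_top" .
  then have "m * T ^ ?d \<le> M * S ^ ?d * 1 ^ ?d"
    by (rule tendsto_lowerbound)
       (auto intro: bound eventually_mono[OF eventually_gt_at_top[of "0::real"]])
  with assms(3,5) show ?thesis by (simp add: field_simps)
qed

text \<open>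
  Each centre is compared with the origin twice: once to obtain the uniform bounds that
  \<open>uniform_counts_compare\<close> needs, and once to return from the origin to \<open>x\<close>. Each comparison
  costs \<open>L\<close> in the radius, hence the factor 2.
\<close>

lemma density_sandwich:
  fixes A :: "'a::euclidean_space set"
  assumes "A \<noteq> {}" and fin: "\<And>x r. finite (A \<inter> ball x r)" and "L > 0"
    and shift: "\<And>x. \<exists>\<sigma>. bij_betw \<sigma> A A \<and> (\<forall>a\<in>A. norm (a + x - \<sigma> a) < L)"
  obtains D :: real where "D > 0"
    and "\<And>x T. T > 2 * L \<Longrightarrow> D * (T - 2 * L) ^ DIM('a) \<le> real (card (A \<inter> ball x T))"
    and "\<And>x T. T > 2 * L \<Longrightarrow> real (card (A \<inter> ball x T)) \<le> D * (T + 2 * L) ^ DIM('a)"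
proof -
  let ?d = "DIM('a)"
  define n where "n T = real (card (A \<inter> ball 0 T))" for T
  note shift_le = card_ball_shift_le[OF fin shift]
  have upper: "real (card (A \<inter> ball x T)) \<le> n (T + L)" for x T
    using shift_le[of x T 0] by (simp add: n_def)
  have lower: "n (T - L) \<le> real (card (A \<inter> ball x T))" for x T
    using shift_le[of 0 "T - L" x] by (simp add: n_def)
  have compare: "n (S - L) / S ^ ?d \<le> n (T + L) / T ^ ?d" if "S > 0" "T > 0" for S T
    by (rule uniform_counts_compare[OF fin lower \<open>S > 0\<close> upper \<open>T > 0\<close>])
  define D where "D = (SUP S\<in>{0<..}. n (S - L) / S ^ ?d)"
  have bdd: "bdd_above ((\<lambda>S. n (S - L) / S ^ ?d) ` {0<..})"
    using compare[of _ 1] by (intro bdd_aboveI2[where M = "n (1 + L) / 1 ^ ?d"]) auto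
  have below: "n (S - L) / S ^ ?d \<le> D" if "S > 0" for S
    unfolding D_def using that by (intro cSUP_upper bdd) auto
  have above: "D \<le> n (T + L) / T ^ ?d" if "T > 0" for T
    unfolding D_def using that by (intro cSUP_least compare) auto
  have "D > 0"
  proof -
    obtain a where "a \<in> A" using assms(1) by blast
    \<comment> \<open>the ball of radius \<open>S - L\<close> about the origin contains \<open>a\<close>\<close>
    define S where "S = L + norm a + 1"
    have "S > 0" using \<open>L > 0\<close> by (simp add: S_def add_pos_nonneg)
    have "a \<in> A \<inter> ball 0 (S - L)" using \<open>a \<in> A\<close> by (simp add: S_def)
    then have "card (A \<inter> ball 0 (S - L)) > 0" using fin by (auto simp: card_gt_0_iff)
    then have "n (S - L) / S ^ ?d > 0" using \<open>S > 0\<close> by (simp add: n_def)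
    with below[OF \<open>S > 0\<close>] show ?thesis by linarith
  qed
  moreover have "D * (T - 2 * L) ^ ?d \<le> real (card (A \<inter> ball x T))" if "T > 2 * L" for x T
  proof -
    have "D * (T - 2 * L) ^ ?d \<le> n (T - L)"
      using above[of "T - 2 * L"] that by (simp add: field_simps)
    with lower[of T x] show ?thesis by linarith
  qed
  moreover have "real (card (A \<inter> ball x T)) \<le> D * (T + 2 * L) ^ ?d" if "T > 2 * L" for x T
  proof -
    have "n (T + L) \<le> D * (T + 2 * L) ^ ?d"
      using below[of "T + 2 * L"] that \<open>L > 0\<close> by (simp add: field_simps)
    with upper[of x T] show ?thesis by linarith
  qed
  ultimately show thesis by (rule that)
qed

lemma uniform_limit_squeeze_const:
  fixes f :: "'a \<Rightarrow> 'b \<Rightarrow> real"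
  assumes "(l \<longlongrightarrow> D) F" "(u \<longlongrightarrow> D) F"
    and "\<forall>\<^sub>F t in F. \<forall>x. l t \<le> f t x \<and> f t x \<le> u t"
  shows "uniform_limit X f (\<lambda>_. D) F"
proof (rule uniform_limitI)
  fix e :: real assume "e > 0"
  from tendstoD[OF assms(1) this] tendstoD[OF assms(2) this] assms(3)
  show "\<forall>\<^sub>F t in F. \<forall>x\<in>X. dist (f t x) D < e"
  proof eventually_elim
    case (elim t)
    show ?case
    proof
      fix x
      have "l t \<le> f t x" "f t x \<le> u t" using elim(3) by auto
      with elim(1,2) show "dist (f t x) D < e" by (simp add: dist_real_def abs_less_iff)
    qed
  qed
qed

theorem theorem1:
  fixes A :: "(real ^ 'n) set"
  assumes "A \<noteq> {}" and "roughly_shift_invariant A"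
  shows "\<exists>D::real. D > 0 \<and>
    uniform_limit UNIV
      (\<lambda>T x. real (card (A \<inter> ball x T)) / measure lebesgue (ball x T)) (\<lambda>x. D) at_top"
proof -
  let ?d = "DIM(real ^ 'n)"
  let ?c = "unit_ball_vol (real ?d)"
  have fin: "\<And>x r. finite (A \<inter> ball x r)"
    using assms(2) by (auto simp: roughly_shift_invariant_def discrete_set_def)
  obtain L where L: "L > 0"
    "\<And>x. \<exists>\<sigma>. bij_betw \<sigma> A A \<and> (\<forall>a\<in>A. norm (a + x - \<sigma> a) < L)"
    using roughly_shift_invariantE[OF assms] by metis
  obtain D where D: "D > 0"
    "\<And>x T. T > 2 * L \<Longrightarrow> D * (T - 2 * L) ^ ?d \<le> real (card (A \<inter> ball x T))"
    "\<And>x T. T > 2 * L \<Longrightarrow> real (card (A \<inter> ball x T)) \<le> D * (T + 2 * L) ^ ?d"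
    using density_sandwich[OF assms(1) fin L] by metis
  have c: "?c > 0" by (rule unit_ball_vol_pos) simp
  have lim: "((\<lambda>T. D / ?c * (1 + k / T) ^ ?d) \<longlongrightarrow> D / ?c) at_top" for k
  proof -
    have "((\<lambda>T. k / T) \<longlongrightarrow> 0) at_top"
      by (intro tendsto_divide_0[OF tendsto_const] filterlim_at_top_imp_at_infinity filterlim_ident)
    then have "((\<lambda>T. D / ?c * (1 + k / T) ^ ?d) \<longlongrightarrow> D / ?c * (1 + 0) ^ ?d) at_top"
      by (intro tendsto_intros)
    then show ?thesis by simp
  qed
  have scale: "D / ?c * (1 + k / T) ^ ?d = D * (T + k) ^ ?d / (?c * T ^ ?d)" if "T > 0" for k T
  proof -
    have "1 + k / T = (T + k) / T" using that by (simp add: field_simps)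
    then show ?thesis by (simp add: power_divide)
  qed
  have "uniform_limit UNIV
      (\<lambda>T x. real (card (A \<inter> ball x T)) / measure lebesgue (ball x T)) (\<lambda>_. D / ?c) at_top"
  proof (rule uniform_limit_squeeze_const[OF lim[of "- 2 * L"] lim[of "2 * L"]])
    show "\<forall>\<^sub>F T in at_top. \<forall>x.
        D / ?c * (1 + - 2 * L / T) ^ ?d \<le> real (card (A \<inter> ball x T)) / measure lebesgue (ball x T) \<and>
        real (card (A \<inter> ball x T)) / measure lebesgue (ball x T) \<le> D / ?c * (1 + 2 * L / T) ^ ?d"
      using eventually_gt_at_top[of "2 * L"]
    proof eventually_elim
      case (elim T)
      with L(1) have "T > 0" by linarith
      then have vol: "measure lebesgue (ball x T) = ?c * T ^ ?d" for x :: "real ^ 'n"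
        by (simp add: measure_completion content_ball)
      have "?c * T ^ ?d > 0" using c \<open>T > 0\<close> by simp
      then show ?case
        unfolding vol scale[OF \<open>T > 0\<close>]
        using D(2,3)[OF elim] by (simp add: divide_right_mono)
    qed
  qed
  with D(1) c show ?thesis by (intro exI[of _ "D / ?c"]) simp
qed

end
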